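(* Let $1\le m<n$, put $d=n-m$, and let $a\ne b$ be two fixed distinct columns. Let $R$ be a uniformly random $m\times n$ Latin rectangle and $Z=|S_a(R)\cap S_b(R)|$. Then $$\operatorname{Var}Z=\frac{m(m-1)d}{(n-1)^2}-\frac{\mathbb E B_{ab}(R)}{n-1}.$$ In particular, $$\operatorname{Var}Z\le\frac{m(m-1)d}{(n-1)^2}.$$
   Context: An $m\times n$ Latin rectangle is an $m\times n$ array with entries in $[n]=\{1,\dots,n\}$ such that every row is a permutation of $[n]$ and no symbol is repeated in a column. For a column $c$, $S_c=S_c(R)\subseteq[n]$ is the set of the $m$ symbols occurring in column $c$ of $R$. For distinct columns $a,h$, the $(a,h)$-digraph of $R$ is the directed graph on vertex set $[n]$ with one directed edge $R_{r,a}\to R_{r,h}$ for every row $r$. Every vertex has indegree and outdegree at most one, so every nonisolated component is a directed cycle or a directed path (with at least one edge). A path component is a component that is a directed path with at least one edge. For a path component $Q$, $\partial Q$ denotes the set of its two endpoint symbols (initial and terminal vertex). The anchored blocker count is $$B_{ab}(R)=\#\{(h,Q):\ h\ne a\text{ a column},\ Q\text{ a path component of the }(a,h)\text{-digraph of }R,\ \partial Q\subseteq S_b(R)\}.$$ *)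

theory Defs
  imports "HOL-Probability.Probability" "HOL-Combinatorics.Permutations"
    "Graph_Theory.Graph_Theory"
begin

text \<open>
  Rows and columns are indexed from 1; the entry in row \<open>r\<close> and column \<open>c\<close> of \<open>R\<close> is \<open>R r c\<close>.
  Outside the \<open>m \<times> n\<close> array the values of \<open>R\<close> are pinned down (by \<open>\<rightarrow>\<^sub>E\<close> for the rows, by
  \<open>permutes\<close> for the columns), so every rectangle is represented by exactly one function and
  \<open>latin_rectangles m n\<close> is a finite set, nonempty for \<open>m \<le> n\<close>.
\<close>

definition latin_rectangles :: "nat \<Rightarrow> nat \<Rightarrow> (nat \<Rightarrow> nat \<Rightarrow> nat) set" where
  "latin_rectangles m n =
     {R \<in> {1..m} \<rightarrow>\<^sub>E {p. p permutes {1..n}}. \<forall>c\<in>{1..n}. inj_on (\<lambda>r. R r c) {1..m}}"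

definition column_symbols :: "nat \<Rightarrow> (nat \<Rightarrow> nat \<Rightarrow> nat) \<Rightarrow> nat \<Rightarrow> nat set" where
  "column_symbols m R c = (\<lambda>r. R r c) ` {1..m}"

text \<open>The arcs of the \<open>(a, h)\<close>-digraph are the rows themselves.\<close>

definition column_digraph ::
  "nat \<Rightarrow> nat \<Rightarrow> (nat \<Rightarrow> nat \<Rightarrow> nat) \<Rightarrow> nat \<Rightarrow> nat \<Rightarrow> (nat, nat) pre_digraph" where
  "column_digraph m n R a h =
     \<lparr>verts = {1..n}, arcs = {1..m}, tail = (\<lambda>r. R r a), head = (\<lambda>r. R r h)\<rparr>"

text \<open>\<open>Q\<close> as a whole is a directed path from \<open>u\<close> to \<open>v\<close> with at least one arc.\<close>

definition directed_path :: "('a, 'b) pre_digraph \<Rightarrow> 'a \<Rightarrow> 'a \<Rightarrow> bool" where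
  "directed_path Q u v \<longleftrightarrow>
     (\<exists>p. p \<noteq> [] \<and> pre_digraph.apath Q u p v \<and>
          verts Q = set (pre_digraph.awalk_verts Q u p) \<and> arcs Q = set p)"

text \<open>
  Components are maximal connected subgraphs; \<^const>\<open>Digraph_Component.connected\<close> ignores the
  direction of the arcs, so these are the weak components.
\<close>

definition path_components :: "('a, 'b) pre_digraph \<Rightarrow> ('a, 'b) pre_digraph set" where
  "path_components G =
     {Q. pre_digraph.max_subgraph G Digraph_Component.connected Q \<and> (\<exists>u v. directed_path Q u v)}"

text \<open>For a directed path \<open>Q\<close> the pair \<open>(u, v)\<close> below is unique.\<close>

definition path_endpoints :: "('a, 'b) pre_digraph \<Rightarrow> 'a set" where
  "path_endpoints Q = \<Union>{{u, v} | u v. directed_path Q u v}"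

definition anchored_blockers ::
  "nat \<Rightarrow> nat \<Rightarrow> nat \<Rightarrow> nat \<Rightarrow> (nat \<Rightarrow> nat \<Rightarrow> nat) \<Rightarrow> nat" where
  "anchored_blockers m n a b R =
     card {(h, Q). h \<in> {1..n} \<and> h \<noteq> a \<and> Q \<in> path_components (column_digraph m n R a h) \<and>
                   path_endpoints Q \<subseteq> column_symbols m R b}"

definition overlap :: "nat \<Rightarrow> nat \<Rightarrow> nat \<Rightarrow> (nat \<Rightarrow> nat \<Rightarrow> nat) \<Rightarrow> nat" where
  "overlap m a b R = card (column_symbols m R a \<inter> column_symbols m R b)"

definition uniform_latin_rectangle :: "nat \<Rightarrow> nat \<Rightarrow> (nat \<Rightarrow> nat \<Rightarrow> nat) pmf" where
  "uniform_latin_rectangle m n = pmf_of_set (latin_rectangles m n)"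

end

theory Submission
  imports Defs
begin

text \<open>
The proof is a detailed balance argument. Write \<open>Z\<close> for the overlap of columns \<open>a\<close> and \<open>b\<close>. Given a rectangle
\<open>R\<close>, a third column \<open>h\<close> and a path component \<open>Q\<close> of the \<open>(a, h)\<close>-digraph, exchange the entries of columns \<open>a\<close> and
\<open>h\<close> in the rows of \<open>Q\<close>. The result is again a Latin rectangle, in which \<open>Q\<close> with all arcs reversed is a path
component, so that switching is an involution on the triples \<open>(R, h, Q)\<close>. Hence, for every statistic \<open>g\<close>,
the sum of \<open>g R' - g R\<close> over all triples vanishes, where \<open>R'\<close> is the switched rectangle
(\<open>sum_all_switched\<close>).

If \<open>Q\<close> runs from \<open>u\<close> to \<open>v\<close>, column \<open>a\<close> loses \<open>u\<close> and gains \<open>v\<close>, so \<open>Z\<close> changes by \<open>[v \<in> S\<^sub>b] - [u \<in> S\<^sub>b]\<close>. The initial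
symbols of the paths are the elements of \<open>S\<^sub>a - S\<^sub>h\<close>, the terminal ones those of \<open>S\<^sub>h - S\<^sub>a\<close>, and every symbol
lies in exactly \<open>m\<close> columns; double counting then evaluates, for each fixed \<open>R\<close>, the sum of the changes as
\<open>m(m - 1) - (n - 1)Z\<close> and the sum of their squares as \<open>m(m - 1) + (n + 1 - 2m)Z - 2B\<close> (\<open>sum_overlap_change\<close>,
\<open>sum_overlap_change_squares\<close>). The balance identity for \<open>g = Z\<close> gives the mean of \<open>Z\<close>, and for \<open>g = Z\<^sup>2\<close> it gives
the second moment, from which the variance formula follows by algebra. The bound holds because \<open>B\<close> is
nonnegative.

Path components are handled as lists of rows, the maximal trails below; \<open>bij_betw_trail_digraph\<close>
identifies them with the path components of the digraph.
\<close>

section \<open>Maximal trails of a system of arcs\<close>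

text \<open>
A path component of a digraph with in- and outdegrees at most one is determined by the list of its
arcs in path order, and such lists are what the switching argument manipulates: reversing a
component is reversing a list. The arcs are abstracted to a set \<open>A\<close> with arbitrary tail and head maps,
so that exchanging the two maps reverses every arc.
\<close>

definition maximal_trails :: "('b \<Rightarrow> 'a) \<Rightarrow> ('b \<Rightarrow> 'a) \<Rightarrow> 'b set \<Rightarrow> 'b list set" where
  "maximal_trails T H A =
     {p. p \<noteq> [] \<and> set p \<subseteq> A \<and> successively (\<lambda>r s. H r = T s) p \<and>
         T (hd p) \<notin> H ` A \<and> H (last p) \<notin> T ` A}"

lemma rev_in_maximal_trails:
  assumes "p \<in> maximal_trails T H A"
  shows "rev p \<in> maximal_trails H T A"
proof -
  have "successively (\<lambda>r s. T s = H r) p"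
    using assms by (auto simp: maximal_trails_def eq_commute elim: successively_mono)
  then show ?thesis
    using assms by (auto simp: maximal_trails_def hd_rev last_rev)
qed

text \<open>
Telescoping: along a trail every head is the next tail, so heads and tails differ only at the two ends.
\<close>

lemma image_heads_tails_of_trail:
  assumes "p \<noteq> []" and "successively (\<lambda>r s. H r = T s) p"
  shows "insert (T (hd p)) (H ` set p) = insert (H (last p)) (T ` set p)"
  using assms
proof (induction p)
  case (Cons e p)
  show ?case
  proof (cases "p = []")
    case False
    then have "insert (T (hd p)) (H ` set p) = insert (H (last p)) (T ` set p)" and "H e = T (hd p)"
      using Cons by (auto simp: successively_Cons)
    then have "insert (T e) (insert (H e) (H ` set p)) = insert (T e) (insert (H (last p)) (T ` set p))"
      by simp
    then show ?thesis using False by (simp add: insert_commute)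
  qed auto
qed simp

locale degree_one_arcs =
  fixes T H :: "'b \<Rightarrow> 'a" and A :: "'b set"
  assumes finite_arcs: "finite A" and inj_tail: "inj_on T A" and inj_head: "inj_on H A"
begin

lemma degree_one_arcs_reverse: "degree_one_arcs H T A"
  by unfold_locales (rule finite_arcs inj_tail inj_head)+

text \<open>
With indegrees at most one, a repeated arc would force its predecessors to coincide as well, and
walking backwards this reaches the first arc, which has no predecessor.
\<close>

lemma distinct_trail_from_source:
  assumes "set p \<subseteq> A" and "successively (\<lambda>r s. H r = T s) p" and "p \<noteq> []" and "T (hd p) \<notin> H ` A"
  shows "distinct p"
  using assms
proof (induction p rule: rev_induct)
  case (snoc e p)
  show ?case
  proof (cases "p = []")
    case False
    then have p: "distinct p" "set p \<subseteq> A" "e \<in> A" "H (last p) = T e"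
      using snoc by (auto simp: successively_append_iff)
    have "e \<notin> set p"
    proof
      assume "e \<in> set p"
      then obtain xs ys where xs: "p = xs @ e # ys"
        by (auto simp: in_set_conv_decomp)
      show False
      proof (cases "xs = []")
        case True
        then have "T (hd (p @ [e])) = H (last p)" using p(4) xs False by simp
        moreover have "last p \<in> A" using p(2) False by auto
        ultimately show False using snoc.prems(4) by simp
      next
        case F: False
        then have "H (last xs) = T e"
          using snoc.prems(2) xs by (auto simp: successively_append_iff)
        then have "H (last xs) = H (last p)" using p(4) by simp
        moreover have "last xs \<in> A" "last p \<in> A" using p(2) xs F False by (auto split: if_splits)
        ultimately have "last xs = last p" using inj_head by (simp add: inj_on_def)
        moreover have "last p \<in> set (e # ys)" using xs by (metis last_appendR last_in_set list.discI)
        moreover have "last xs \<in> set xs" using F by simp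
        ultimately show False using p(1) xs by auto
      qed
    qed
    then show ?thesis using p by simp
  qed simp
qed simp

lemma distinct_maximal_trail: "p \<in> maximal_trails T H A \<Longrightarrow> distinct p"
  by (auto simp: maximal_trails_def intro: distinct_trail_from_source)

text \<open>
Trails starting at a source repeat no arc, so their length is bounded and a longest one exists.
\<close>

lemma exists_maximal_trail_from:
  assumes "u \<in> T ` A - H ` A"
  shows "\<exists>p\<in>maximal_trails T H A. T (hd p) = u"
proof -
  define P where "P p \<longleftrightarrow> p \<noteq> [] \<and> set p \<subseteq> A \<and> successively (\<lambda>r s. H r = T s) p \<and> T (hd p) = u" for p
  obtain e where "e \<in> A" "T e = u" using assms by auto
  then have start: "P [e]" by (simp add: P_def)
  have bounded: "length p < Suc (card A)" if "P p" for p
  proof -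
    have "distinct p"
      using that assms distinct_trail_from_source[of p] by (auto simp: P_def)
    then have "length p = card (set p)" by (simp add: distinct_card)
    also have "\<dots> \<le> card A" using that finite_arcs by (auto simp: P_def intro: card_mono)
    finally show ?thesis by simp
  qed
  obtain p where p: "P p" and longest: "\<And>q. P q \<Longrightarrow> length q \<le> length p"
    using ex_has_greatest_nat[of P "[e]" length "Suc (card A)"] start bounded
    by (metis less_imp_le_nat)
  have "H (last p) \<notin> T ` A"
  proof
    assume "H (last p) \<in> T ` A"
    then obtain f where "f \<in> A" "T f = H (last p)" by auto
    then have "P (p @ [f])" using p by (auto simp: P_def successively_append_iff)
    then show False using longest[of "p @ [f]"] by simp
  qed
  then have "p \<in> maximal_trails T H A"
    using p assms by (auto simp: P_def maximal_trails_def)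
  then show ?thesis using p by (auto simp: P_def)
qed

lemma trail_determined_by_source:
  assumes "p \<noteq> []" "set p \<subseteq> A" "successively (\<lambda>r s. H r = T s) p" "H (last p) \<notin> T ` A"
    and "q \<noteq> []" "set q \<subseteq> A" "successively (\<lambda>r s. H r = T s) q" "H (last q) \<notin> T ` A"
    and "T (hd p) = T (hd q)"
  shows "p = q"
  using assms
proof (induction p arbitrary: q)
  case (Cons e p)
  obtain f q' where q: "q = f # q'" using Cons.prems by (cases q) auto
  have e: "f = e" using Cons.prems q inj_tail by (auto simp: inj_on_def)
  show ?case
  proof (cases "p = [] \<or> q' = []")
    case True
    have "p = [] \<and> q' = []"
    proof (rule ccontr)
      assume "\<not> (p = [] \<and> q' = [])"
      then consider "p = []" "q' \<noteq> []" | "p \<noteq> []" "q' = []" using True by blast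
      then have "H e \<in> T ` A \<and> H e \<notin> T ` A"
      proof cases
        case 1
        then have "H e = T (hd q')" "hd q' \<in> A" using Cons.prems q e by (auto simp: successively_Cons)
        then show ?thesis using Cons.prems 1 by auto
      next
        case 2
        then have "H e = T (hd p)" "hd p \<in> A" using Cons.prems by (auto simp: successively_Cons)
        then show ?thesis using Cons.prems 2 q e by auto
      qed
      then show False by simp
    qed
    then show ?thesis using q e by simp
  next
    case False
    then show ?thesis
      using Cons.prems q e Cons.IH[of q'] by (auto simp: successively_Cons)
  qed
qed simp

text \<open>
Maximal trails are in bijection with the sources, and by reversal with the sinks. This is how sums over
path components become sums over symbols.
\<close>

lemma bij_betw_source: "bij_betw (\<lambda>p. T (hd p)) (maximal_trails T H A) (T ` A - H ` A)"
proof (rule bij_betwI')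
  fix p q assume "p \<in> maximal_trails T H A" "q \<in> maximal_trails T H A"
  then show "(T (hd p) = T (hd q)) = (p = q)"
    using trail_determined_by_source[of p q] by (auto simp: maximal_trails_def)
next
  fix p assume "p \<in> maximal_trails T H A"
  then have "hd p \<in> A" "T (hd p) \<notin> H ` A"
    by (auto simp: maximal_trails_def)
  then show "T (hd p) \<in> T ` A - H ` A" by blast
next
  fix u assume "u \<in> T ` A - H ` A"
  then obtain p where "p \<in> maximal_trails T H A" "T (hd p) = u"
    by (rule exists_maximal_trail_from[THEN bexE])
  then show "\<exists>p\<in>maximal_trails T H A. u = T (hd p)" by (intro bexI[of _ p]) simp_all
qed

lemma bij_betw_rev_maximal_trails: "bij_betw rev (maximal_trails T H A) (maximal_trails H T A)"
  by (rule bij_betw_byWitness[where f' = rev]) (auto intro: rev_in_maximal_trails)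

lemma bij_betw_sink: "bij_betw (\<lambda>p. H (last p)) (maximal_trails T H A) (H ` A - T ` A)"
proof -
  interpret R: degree_one_arcs H T A by (rule degree_one_arcs_reverse)
  have "bij_betw ((\<lambda>p. H (hd p)) \<circ> rev) (maximal_trails T H A) (H ` A - T ` A)"
    by (rule bij_betw_trans[OF bij_betw_rev_maximal_trails R.bij_betw_source])
  moreover have "(\<lambda>p. H (hd p)) \<circ> rev = (\<lambda>p. H (last p))"
    by (simp add: fun_eq_iff hd_rev)
  ultimately show ?thesis by (simp only:)
qed

lemma finite_maximal_trails: "finite (maximal_trails T H A)"
  unfolding bij_betw_finite[OF bij_betw_source] by (intro finite_Diff finite_imageI finite_arcs)

text \<open>
No arc outside a maximal trail touches it. This makes the trail a whole component, and it is
also the reason why switching along it creates no repetition.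
\<close>

lemma maximal_trail_closed_forward:
  assumes p: "p \<in> maximal_trails T H A" and "r \<in> set p" "s \<in> A" "H r = T s"
  shows "s \<in> set p"
proof -
  have "p \<noteq> []" "set p \<subseteq> A" "successively (\<lambda>r s. H r = T s) p" and sink: "H (last p) \<notin> T ` A"
    using p by (simp_all add: maximal_trails_def)
  then have "insert (T (hd p)) (H ` set p) = insert (H (last p)) (T ` set p)"
    by (intro image_heads_tails_of_trail)
  moreover have "T s \<in> H ` set p" using assms(2,4) by (metis imageI)
  ultimately have "T s \<in> insert (H (last p)) (T ` set p)" by (metis insertI2)
  moreover have "T s \<noteq> H (last p)" using sink \<open>s \<in> A\<close> by (metis imageI)
  ultimately have "T s \<in> T ` set p" by simp
  then show ?thesis
    using \<open>set p \<subseteq> A\<close> \<open>s \<in> A\<close> inj_tail by (meson inj_on_image_mem_iff)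
qed

lemma maximal_trail_closed_backward:
  assumes p: "p \<in> maximal_trails T H A" and "s \<in> set p" "r \<in> A" "H r = T s"
  shows "r \<in> set p"
proof -
  interpret R: degree_one_arcs H T A by (rule degree_one_arcs_reverse)
  show ?thesis
    using R.maximal_trail_closed_forward[OF rev_in_maximal_trails[OF p]] assms by simp
qed

text \<open>
Switching reverses the arcs of one maximal trail and leaves the others alone. A clash between a
reversed and an unreversed arc would be an arc touching the trail from outside. The net effect on
the set of tails is that the source is traded for the sink.
\<close>

context
  fixes p
  assumes p: "p \<in> maximal_trails T H A"
begin

lemma inj_on_switch_tail: "inj_on (override_on T H (set p)) A"
proof (rule inj_onI)
  fix r s assume rs: "r \<in> A" "s \<in> A" "override_on T H (set p) r = override_on T H (set p) s"
  show "r = s"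
  proof (cases "r \<in> set p"; cases "s \<in> set p")
    assume "r \<in> set p" "s \<in> set p"
    then show ?thesis using rs inj_head by (simp add: inj_on_def)
  next
    assume "r \<in> set p" "s \<notin> set p"
    then show ?thesis using rs maximal_trail_closed_forward[OF p, of r s] by simp
  next
    assume "r \<notin> set p" "s \<in> set p"
    then show ?thesis using rs maximal_trail_closed_forward[OF p, of s r] by simp
  next
    assume "r \<notin> set p" "s \<notin> set p"
    then show ?thesis using rs inj_tail by (simp add: inj_on_def)
  qed
qed

lemma switch_tail_image:
  "override_on T H (set p) ` A = insert (H (last p)) (T ` A - {T (hd p)})"
proof -
  have sub: "set p \<subseteq> A" and ne: "p \<noteq> []" and src: "T (hd p) \<notin> H ` A" and snk: "H (last p) \<notin> T ` A"
    using p by (simp_all add: maximal_trails_def)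
  have eq: "insert (T (hd p)) (H ` set p) = insert (H (last p)) (T ` set p)"
    using p by (intro image_heads_tails_of_trail) (simp_all add: maximal_trails_def)
  have "H ` set p = insert (H (last p)) (T ` set p) - {T (hd p)}"
  proof -
    have "T (hd p) \<notin> H ` set p" using src sub by auto
    then show ?thesis using eq by (metis Diff_insert_absorb)
  qed
  also have "\<dots> = insert (H (last p)) (T ` set p - {T (hd p)})"
  proof -
    have "T (hd p) \<noteq> H (last p)" using snk sub ne by (metis hd_in_set imageI subsetD)
    then show ?thesis by (simp add: insert_Diff_if)
  qed
  finally have on: "H ` set p = insert (H (last p)) (T ` set p - {T (hd p)})" .
  have "T ` (A - set p) = T ` A - T ` set p"
    using inj_tail sub by (simp add: inj_on_image_set_diff)
  moreover have "override_on T H (set p) ` A = H ` set p \<union> T ` (A - set p)"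
  proof -
    have "A = set p \<union> (A - set p)" using sub by blast
    then have "override_on T H (set p) ` A = override_on T H (set p) ` set p \<union> override_on T H (set p) ` (A - set p)"
      by (metis image_Un)
    then show ?thesis by simp
  qed
  moreover have "T (hd p) \<in> T ` set p" using ne by simp
  moreover have "T ` set p \<subseteq> T ` A" using sub by blast
  moreover have "insert v (Y - {u}) \<union> (X - Y) = insert v (X - {u})" if "u \<in> Y" "Y \<subseteq> X" for u v :: 'a and X Y
    using that by blast
  ultimately show ?thesis using on by simp
qed

end

lemma switch_images:
  assumes p: "p \<in> maximal_trails T H A"
  shows "override_on H T (set p) ` A = insert (T (hd p)) (H ` A - {H (last p)})"
    and "inj_on (override_on H T (set p)) A"
proof -
  interpret R: degree_one_arcs H T A by (rule degree_one_arcs_reverse)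
  have r: "rev p \<in> maximal_trails H T A" "p \<noteq> []"
    using p by (rule rev_in_maximal_trails) (use p in \<open>simp add: maximal_trails_def\<close>)
  show "override_on H T (set p) ` A = insert (T (hd p)) (H ` A - {H (last p)})"
    using R.switch_tail_image[OF r(1)] r(2) by (simp add: hd_rev last_rev)
  show "inj_on (override_on H T (set p)) A"
    using R.inj_on_switch_tail[OF r(1)] by simp
qed

text \<open>
The reversed trail is a maximal trail of the switched system: this makes switching an involution on
pairs of a system and a trail in it.
\<close>

lemma rev_in_switch_maximal_trails:
  assumes p: "p \<in> maximal_trails T H A"
  shows "rev p \<in> maximal_trails (override_on T H (set p)) (override_on H T (set p)) A"
proof -
  have ne: "p \<noteq> []" and sub: "set p \<subseteq> A" and src: "T (hd p) \<notin> H ` A" and snk: "H (last p) \<notin> T ` A"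
    and succ: "successively (\<lambda>r s. H r = T s) p"
    using p by (simp_all add: maximal_trails_def)
  have ends: "H (last p) \<noteq> T (hd p)" using ne sub snk by (metis hd_in_set imageI subsetD)
  have "successively (\<lambda>r s. override_on H T (set p) s = override_on T H (set p) r) p"
    using succ by (rule successively_mono) simp
  moreover have "override_on T H (set p) (last p) \<notin> override_on H T (set p) ` A"
    unfolding switch_images(1)[OF p] using ne ends snk by simp
  moreover have "override_on H T (set p) (hd p) \<notin> override_on T H (set p) ` A"
    unfolding switch_tail_image[OF p] using ne ends src by auto
  ultimately show ?thesis
    using ne sub by (simp add: maximal_trails_def hd_rev last_rev)
qed

end

section \<open>Path components are maximal trails\<close>

definition trail_digraph :: "('a, 'b) pre_digraph \<Rightarrow> 'b list \<Rightarrow> ('a, 'b) pre_digraph" where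
  "trail_digraph G p =
     \<lparr>verts = tail G ` set p \<union> head G ` set p, arcs = set p, tail = tail G, head = head G\<rparr>"

lemma trail_digraph_simps [simp]:
  "verts (trail_digraph G p) = tail G ` set p \<union> head G ` set p"
  "arcs (trail_digraph G p) = set p"
  "tail (trail_digraph G p) = tail G"
  "head (trail_digraph G p) = head G"
  by (simp_all add: trail_digraph_def)

lemma wf_trail_digraph: "wf_digraph (trail_digraph G p)"
  by unfold_locales auto

lemma cas_iff_successively:
  assumes "p \<noteq> []"
  shows "pre_digraph.cas G u p v \<longleftrightarrow>
    tail G (hd p) = u \<and> head G (last p) = v \<and> successively (\<lambda>r s. head G r = tail G s) p"
  using assms
proof (induction p arbitrary: u)
  case (Cons e p)
  show ?case
  proof (cases "p = []")
    case False
    then have "pre_digraph.cas G (head G e) p v \<longleftrightarrow>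
        tail G (hd p) = head G e \<and> head G (last p) = v \<and> successively (\<lambda>r s. head G r = tail G s) p"
      by (rule Cons.IH)
    then show ?thesis
      using False by (simp add: pre_digraph.cas.simps successively_Cons) metis
  qed (simp add: pre_digraph.cas.simps)
qed simp

lemma vertices_of_trail:
  assumes "p \<noteq> []" and "successively (\<lambda>r s. H r = T s) p"
  shows "set (map T p @ [H (last p)]) = T ` set p \<union> H ` set p"
proof -
  have "H ` set p \<subseteq> insert (H (last p)) (T ` set p)"
    using image_heads_tails_of_trail[OF assms] by blast
  moreover have "H (last p) \<in> H ` set p" using assms(1) by simp
  ultimately show ?thesis by auto
qed

text \<open>
The walk language of the digraph library is translated once and for all into conditions on the arc
list; here \<open>map (tail Q) p\<close> followed by the last head is the vertex list of the walk.
\<close>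

lemma directed_path_iff:
  "directed_path Q u v \<longleftrightarrow>
    (\<exists>p. p \<noteq> [] \<and> successively (\<lambda>r s. head Q r = tail Q s) p \<and>
         tail Q (hd p) = u \<and> head Q (last p) = v \<and>
         distinct (map (tail Q) p) \<and> head Q (last p) \<notin> tail Q ` set p \<and>
         verts Q = tail Q ` set p \<union> head Q ` set p \<and> arcs Q = set p)"
proof -
  have "pre_digraph.apath Q u p v \<and> verts Q = set (pre_digraph.awalk_verts Q u p) \<and> arcs Q = set p \<longleftrightarrow>
      successively (\<lambda>r s. head Q r = tail Q s) p \<and>
      tail Q (hd p) = u \<and> head Q (last p) = v \<and>
      distinct (map (tail Q) p) \<and> head Q (last p) \<notin> tail Q ` set p \<and>
      verts Q = tail Q ` set p \<union> head Q ` set p \<and> arcs Q = set p" (is "?L \<longleftrightarrow> ?R") if "p \<noteq> []" for p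
  proof -
    have av: "pre_digraph.awalk_verts Q u p = map (tail Q) p @ [head Q (last p)]"
      using that by (simp add: pre_digraph.awalk_verts_conv)
    show ?thesis
    proof
      assume L: ?L
      then have s: "successively (\<lambda>r s. head Q r = tail Q s) p" "tail Q (hd p) = u" "head Q (last p) = v"
        using that by (simp_all add: pre_digraph.apath_def pre_digraph.awalk_def cas_iff_successively)
      moreover have "distinct (map (tail Q) p @ [head Q (last p)])"
        using L by (simp only: av pre_digraph.apath_def)
      moreover have "verts Q = tail Q ` set p \<union> head Q ` set p"
        using L vertices_of_trail[OF that s(1)] by (simp only: av)
      ultimately show ?R using L by simp
    next
      assume R: ?R
      have "u \<in> verts Q" using R that by auto
      moreover have "distinct (map (tail Q) p @ [head Q (last p)])"
        using R unfolding distinct_append by auto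
      moreover have "verts Q = set (map (tail Q) p @ [head Q (last p)])"
        using R vertices_of_trail[OF that, of "head Q" "tail Q"] by simp
      ultimately show ?L
        unfolding av pre_digraph.apath_def pre_digraph.awalk_def
        using R that by (simp add: cas_iff_successively)
    qed
  qed
  then show ?thesis
    unfolding directed_path_def by (intro ex_cong1 conj_cong[OF refl])
qed

lemma arc_in_symcl_arcs_ends:
  assumes "e \<in> arcs G"
  shows "(tail G e, head G e) \<in> symcl (arcs_ends G)" and "(head G e, tail G e) \<in> symcl (arcs_ends G)"
  using assms by (auto simp: symcl_def arcs_ends_conv image_iff)

lemma connected_if_root:
  assumes x: "x \<in> verts G" and "\<And>y. y \<in> verts G \<Longrightarrow> (x, y) \<in> rtrancl_on (verts G) (symcl (arcs_ends G))"
  shows "Digraph_Component.connected G"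
proof -
  have "sym (symcl (arcs_ends G))" by (auto simp: symcl_def sym_def)
  then have "sym (rtrancl_on (verts G) (symcl (arcs_ends G)))" by (rule rtrancl_on_sym)
  then have "(u, v) \<in> rtrancl_on (verts G) (symcl (arcs_ends G))" if "u \<in> verts G" "v \<in> verts G" for u v
    using assms(2)[OF that(1)] assms(2)[OF that(2)] by (meson rtrancl_on_trans symD)
  then show ?thesis using x by (auto simp: connected_conv)
qed

text \<open>
Connectivity survives adding an arc at a vertex already present. Iterated along a trail this shows that
trails are connected; applied to a component it shows, by maximality, that the component contains
every arc touching it.
\<close>

lemma connected_insert_arc:
  assumes conn: "Digraph_Component.connected Q" and e: "tail Q e \<in> verts Q \<or> head Q e \<in> verts Q"
  shows "Digraph_Component.connected
    (Q\<lparr>verts := insert (tail Q e) (insert (head Q e) (verts Q)), arcs := insert e (arcs Q)\<rparr>)"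
    (is "Digraph_Component.connected ?Q'")
proof -
  let ?R = "rtrancl_on (verts ?Q') (symcl (arcs_ends ?Q'))"
  obtain x where x: "x \<in> verts Q" "x = tail Q e \<or> x = head Q e" using e by blast
  have old: "(x, y) \<in> ?R" if "y \<in> verts Q" for y
  proof -
    have "(x, y) \<in> rtrancl_on (verts Q) (symcl (arcs_ends Q))"
      using conn x(1) that by (auto simp: connected_conv)
    moreover have "verts Q \<subseteq> verts ?Q'" "symcl (arcs_ends Q) \<subseteq> symcl (arcs_ends ?Q')"
      by (auto simp: symcl_def arcs_ends_conv)
    ultimately show ?thesis by (metis rtrancl_on_mono)
  qed
  have new: "(x, y) \<in> ?R" if "y = tail Q e \<or> y = head Q e" for y
  proof (cases "y = x")
    case True
    then show ?thesis using old x by simp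
  next
    case False
    then have "(x, y) \<in> symcl (arcs_ends ?Q')"
      using x that arc_in_symcl_arcs_ends[of e ?Q'] by auto
    then show ?thesis
      using old[OF x(1)] that by (auto intro: rtrancl_on_into_rtrancl_on)
  qed
  show ?thesis
  proof (rule connected_if_root[of x])
    show "x \<in> verts ?Q'" using x by simp
    show "(x, y) \<in> ?R" if "y \<in> verts ?Q'" for y
      using that old new by auto
  qed
qed

lemma connected_trail_digraph:
  assumes "p \<noteq> []" and "successively (\<lambda>r s. head G r = tail G s) p"
  shows "Digraph_Component.connected (trail_digraph G p)"
  using assms
proof (induction p rule: rev_induct)
  case (snoc e p)
  show ?case
  proof (cases "p = []")
    case True
    have "(tail G e, y) \<in> rtrancl_on {tail G e, head G e} (symcl (arcs_ends (trail_digraph G [e])))"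
      if "y = tail G e \<or> y = head G e" for y
      using that arc_in_symcl_arcs_ends[of e "trail_digraph G [e]"]
      by (auto intro: rtrancl_on_into_rtrancl_on)
    then show ?thesis
      using True by (intro connected_if_root[of "tail G e"]) (auto simp: insert_commute)
  next
    case False
    let ?Q = "trail_digraph G p"
    have "Digraph_Component.connected ?Q" and "tail G e = head G (last p)"
      using snoc False by (auto simp: successively_append_iff)
    then have "Digraph_Component.connected
        (?Q\<lparr>verts := insert (tail ?Q e) (insert (head ?Q e) (verts ?Q)), arcs := insert e (arcs ?Q)\<rparr>)"
      using False by (intro connected_insert_arc) auto
    moreover have "?Q\<lparr>verts := insert (tail ?Q e) (insert (head ?Q e) (verts ?Q)), arcs := insert e (arcs ?Q)\<rparr>
        = trail_digraph G (p @ [e])"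
      by (auto simp: trail_digraph_def)
    ultimately show ?thesis by simp
  qed
qed simp

lemma arc_in_connected_component:
  assumes max: "pre_digraph.max_subgraph G Digraph_Component.connected Q"
    and "e \<in> arcs G" and "tail G e \<in> verts Q \<or> head G e \<in> verts Q"
  shows "e \<in> arcs Q"
proof -
  let ?Q' = "Q\<lparr>verts := insert (tail Q e) (insert (head Q e) (verts Q)), arcs := insert e (arcs Q)\<rparr>"
  have sub: "subgraph Q G" and conn: "Digraph_Component.connected Q"
    using max by (simp_all add: pre_digraph.max_subgraph_def)
  then have Q: "wf_digraph Q" "wf_digraph G" "tail Q = tail G" "head Q = head G"
      "verts Q \<subseteq> verts G" "arcs Q \<subseteq> arcs G"
    by (auto simp: subgraph_def compatible_def)
  have wf': "wf_digraph ?Q'"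
    using Q(1) by (auto simp: wf_digraph_def)
  have "Digraph_Component.connected ?Q'"
    using conn assms(3) by (intro connected_insert_arc) (simp_all add: Q)
  moreover have "subgraph ?Q' G" "subgraph Q ?Q'"
    using Q wf' assms(2) by (auto simp: subgraph_def compatible_def wf_digraph_def)
  ultimately have "?Q' = Q"
    using max by (auto simp: pre_digraph.max_subgraph_def)
  then have "arcs ?Q' = arcs Q" by simp
  then show ?thesis by auto
qed

locale degree_one_digraph = wf_digraph G + degree_one_arcs "tail G" "head G" "arcs G"
  for G :: "('a, 'b) pre_digraph" (structure)
begin

lemma arc_of_maximal_trail:
  assumes p: "p \<in> maximal_trails (tail G) (head G) (arcs G)" and e: "e \<in> arcs G"
    and "tail G e \<in> tail G ` set p \<union> head G ` set p \<or> head G e \<in> tail G ` set p \<union> head G ` set p"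
  shows "e \<in> set p"
proof -
  have sub: "set p \<subseteq> arcs G" using p by (simp add: maximal_trails_def)
  obtain r where r: "r \<in> set p"
    and "tail G e = tail G r \<or> tail G e = head G r \<or> head G e = tail G r \<or> head G e = head G r"
    using assms(3) by auto
  then consider "tail G e = tail G r" | "head G r = tail G e" | "head G e = tail G r" | "head G e = head G r"
    by metis
  then show ?thesis
  proof cases
    case 1
    then show ?thesis using r sub e inj_tail by (metis inj_onD subsetD)
  next
    case 2
    then show ?thesis using maximal_trail_closed_forward[OF p r e] by simp
  next
    case 3
    then show ?thesis using maximal_trail_closed_backward[OF p r e] by simp
  next
    case 4
    then show ?thesis using r sub e inj_head by (metis inj_onD subsetD)
  qed
qed

lemma directed_path_trail_digraph:
  assumes p: "p \<in> maximal_trails (tail G) (head G) (arcs G)"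
  shows "directed_path (trail_digraph G p) (tail G (hd p)) (head G (last p))"
proof -
  have p': "p \<noteq> []" "successively (\<lambda>r s. head G r = tail G s) p"
      "head G (last p) \<notin> tail G ` arcs G" "set p \<subseteq> arcs G"
    using p by (simp_all add: maximal_trails_def)
  have "distinct (map (tail G) p)"
    using distinct_maximal_trail[OF p] p'(4) inj_tail by (simp add: distinct_map inj_on_subset)
  moreover have "head G (last p) \<notin> tail G ` set p" using p'(3,4) by blast
  ultimately show ?thesis
    unfolding directed_path_iff using p'(1,2) by (intro exI[of _ p]) simp
qed

text \<open>
A connected subgraph extending the trail could only grow through an arc that touches the trail, and
all of those belong to it.
\<close>

lemma trail_digraph_in_path_components:
  assumes p: "p \<in> maximal_trails (tail G) (head G) (arcs G)"
  shows "trail_digraph G p \<in> path_components G"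
proof -
  let ?Q = "trail_digraph G p"
  have p': "p \<noteq> []" "successively (\<lambda>r s. head G r = tail G s) p" "set p \<subseteq> arcs G"
    using p by (simp_all add: maximal_trails_def)
  have "subgraph ?Q G"
    using p'(3) wf_trail_digraph wf_digraph by (auto simp: subgraph_def compatible_def)
  moreover have "Digraph_Component.connected ?Q"
    using p'(1,2) by (rule connected_trail_digraph)
  moreover have "H' = ?Q"
    if sub: "subgraph ?Q H'" and sub': "subgraph H' G" and conn: "Digraph_Component.connected H'" for H'
  proof -
    have H': "verts ?Q \<subseteq> verts H'" "arcs ?Q \<subseteq> arcs H'" "tail H' = tail G" "head H' = head G"
        "arcs H' \<subseteq> arcs G" "wf_digraph H'"
      using sub sub' by (auto simp: subgraph_def compatible_def)
    define u where "u = tail G (hd p)"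
    have u: "u \<in> verts ?Q" using p'(1) by (simp add: u_def)
    have vs: "y \<in> verts ?Q" if "y \<in> verts H'" for y
    proof -
      have "(u, y) \<in> rtrancl_on (verts H') (symcl (arcs_ends H'))"
        using conn u H'(1) that by (metis connected_conv subsetD)
      then show ?thesis
      proof (induction rule: rtrancl_on_induct)
        case base
        then show ?case using u by simp
      next
        case (step y z)
        then obtain e where e: "e \<in> arcs H'"
          and yz: "(y, z) = (tail G e, head G e) \<or> (y, z) = (head G e, tail G e)"
          using H'(3,4) by (auto simp: symcl_def arcs_ends_conv)
        have "y \<in> tail G ` set p \<union> head G ` set p" using step.IH by simp
        moreover have "y = tail G e \<or> y = head G e" using yz by blast
        ultimately have
          "tail G e \<in> tail G ` set p \<union> head G ` set p \<or> head G e \<in> tail G ` set p \<union> head G ` set p"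
          by metis
        then have "e \<in> set p"
          using e H'(5) by (intro arc_of_maximal_trail[OF p]) (rule subsetD)
        then show ?case using yz by auto
      qed
    qed
    have "e \<in> set p" if "e \<in> arcs H'" for e
    proof -
      have "tail G e \<in> verts H'" using wf_digraph.tail_in_verts[OF H'(6) that] H'(3) by simp
      then have "tail G e \<in> tail G ` set p \<union> head G ` set p" using vs by fastforce
      then show ?thesis using that H'(5) by (intro arc_of_maximal_trail[OF p] disjI1) (rule subsetD)
    qed
    then have "arcs H' = arcs ?Q" using H'(2) by auto
    moreover have "verts H' = verts ?Q" using vs H'(1) by blast
    ultimately show "H' = ?Q" using H'(3,4) by (intro pre_digraph.equality) auto
  qed
  ultimately have "max_subgraph Digraph_Component.connected ?Q"
    unfolding max_subgraph_def by (metis (no_types, lifting))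
  then show ?thesis
    unfolding path_components_def mem_Collect_eq
    by (intro conjI exI) (assumption, rule directed_path_trail_digraph[OF p])
qed

text \<open>
Conversely, an arc of the digraph entering the initial vertex or leaving the terminal vertex of a path
component would lie in the component itself, and then a vertex of the path would repeat.
\<close>

lemma directed_path_component_is_trail:
  assumes Q: "Q \<in> path_components G" and uv: "directed_path Q u v"
  obtains p where "p \<in> maximal_trails (tail G) (head G) (arcs G)" "Q = trail_digraph G p"
    "u = tail G (hd p)" "v = head G (last p)"
proof -
  have max: "max_subgraph Digraph_Component.connected Q"
    using Q by (simp add: path_components_def)
  then have sub: "tail Q = tail G" "head Q = head G" "arcs Q \<subseteq> arcs G"
    by (auto simp: max_subgraph_def subgraph_def compatible_def)
  obtain p where p: "p \<noteq> []" "successively (\<lambda>r s. head G r = tail G s) p"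
      "tail G (hd p) = u" "head G (last p) = v" "distinct (map (tail G) p)"
      "head G (last p) \<notin> tail G ` set p" "verts Q = tail G ` set p \<union> head G ` set p" "arcs Q = set p"
    using uv unfolding directed_path_iff sub by (elim exE conjE) (rule that)
  have "head G (last p) \<notin> tail G ` arcs G"
  proof
    assume "head G (last p) \<in> tail G ` arcs G"
    then obtain e where e: "e \<in> arcs G" "tail G e = head G (last p)" by auto
    then have "e \<in> arcs Q"
      using p(1,7) by (intro arc_in_connected_component[OF max]) auto
    then show False using e p(6,8) by (metis imageI)
  qed
  moreover have "tail G (hd p) \<notin> head G ` arcs G"
  proof
    assume "tail G (hd p) \<in> head G ` arcs G"
    then obtain e where e: "e \<in> arcs G" "head G e = tail G (hd p)" by auto
    then have "e \<in> arcs Q"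
      using p(1,7) by (intro arc_in_connected_component[OF max]) auto
    then have "e \<in> set p" using p(8) by simp
    then obtain xs ys where xs: "p = xs @ e # ys" by (auto simp: in_set_conv_decomp)
    show False
    proof (cases ys)
      case Nil
      then show False using e p(1,6) xs by (metis hd_in_set imageI last_snoc)
    next
      case (Cons f zs)
      then have "tail G f = tail G (hd p)" "f \<in> set (tl p)"
        using p(2) xs e by (auto simp: successively_append_iff successively_Cons tl_append split: list.splits)
      then have "tail G (hd p) \<in> tail G ` set (tl p)" by (metis imageI)
      then show False using p(1,5) by (cases p) simp_all
    qed
  qed
  ultimately have "p \<in> maximal_trails (tail G) (head G) (arcs G)"
    using p(1,2,8) sub(3) by (simp add: maximal_trails_def)
  moreover have "Q = trail_digraph G p"
    using p(7,8) sub by (intro pre_digraph.equality) auto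
  ultimately show thesis using that p(3,4) by blast
qed

text \<open>
The digraph of a trail remembers only the set of arcs, but the first arc is recovered as the only one
whose tail is not a head, and the source determines the trail.
\<close>

lemma inj_on_trail_digraph: "inj_on (trail_digraph G) (maximal_trails (tail G) (head G) (arcs G))"
proof (rule inj_onI)
  fix p q assume p: "p \<in> maximal_trails (tail G) (head G) (arcs G)"
    and q: "q \<in> maximal_trails (tail G) (head G) (arcs G)" and eq: "trail_digraph G p = trail_digraph G q"
  have "set p = set q" using arg_cong[OF eq, of arcs] by simp
  moreover have p': "p \<noteq> []" "set p \<subseteq> arcs G" "tail G (hd p) \<notin> head G ` arcs G"
    using p by (simp_all add: maximal_trails_def)
  ultimately have "hd p \<in> set q" by (metis hd_in_set)
  then have "tail G (hd p) \<in> insert (head G (last q)) (tail G ` set q)" by simp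
  also have "\<dots> = insert (tail G (hd q)) (head G ` set q)"
    using q by (intro image_heads_tails_of_trail[symmetric]) (simp_all add: maximal_trails_def)
  finally have "tail G (hd p) = tail G (hd q)"
    using p' \<open>set p = set q\<close> by (metis image_mono insert_iff subsetD)
  then show "p = q"
    using bij_betw_imp_inj_on[OF bij_betw_source] p q by (simp add: inj_on_def)
qed

lemma bij_betw_trail_digraph:
  "bij_betw (trail_digraph G) (maximal_trails (tail G) (head G) (arcs G)) (path_components G)"
proof -
  have "path_components G \<subseteq> trail_digraph G ` maximal_trails (tail G) (head G) (arcs G)"
  proof
    fix Q assume Q: "Q \<in> path_components G"
    then obtain u v where "directed_path Q u v" by (auto simp: path_components_def)
    with Q obtain p where "p \<in> maximal_trails (tail G) (head G) (arcs G)" "Q = trail_digraph G p"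
      by (rule directed_path_component_is_trail)
    then show "Q \<in> trail_digraph G ` maximal_trails (tail G) (head G) (arcs G)" by simp
  qed
  then show ?thesis
    using inj_on_trail_digraph trail_digraph_in_path_components
    unfolding bij_betw_def by (intro conjI subset_antisym image_subsetI)
qed

lemma path_endpoints_trail_digraph:
  assumes p: "p \<in> maximal_trails (tail G) (head G) (arcs G)"
  shows "path_endpoints (trail_digraph G p) = {tail G (hd p), head G (last p)}"
proof -
  have "u = tail G (hd p) \<and> v = head G (last p)" if path: "directed_path (trail_digraph G p) u v" for u v
  proof -
    obtain q where "q \<in> maximal_trails (tail G) (head G) (arcs G)" "trail_digraph G p = trail_digraph G q"
        "u = tail G (hd q)" "v = head G (last q)"
      using trail_digraph_in_path_components[OF p] path by (rule directed_path_component_is_trail)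
    then show ?thesis using inj_on_trail_digraph p by (metis inj_onD)
  qed
  then have "directed_path (trail_digraph G p) u v \<longleftrightarrow> u = tail G (hd p) \<and> v = head G (last p)" for u v
    using directed_path_trail_digraph[OF p] by metis
  then show ?thesis unfolding path_endpoints_def by simp
qed

end

section \<open>Symbols in the columns of a Latin rectangle\<close>

lemma finite_latin_rectangles: "finite (latin_rectangles m n)"
proof -
  have "finite ({1..m} \<rightarrow>\<^sub>E {p. p permutes {1..n}})"
    by (intro finite_PiE finite_permutations) auto
  then show ?thesis by (rule finite_subset[rotated]) (auto simp: latin_rectangles_def)
qed

lemma mod_shift_inj:
  fixes x y k n :: nat
  assumes "x \<in> {1..n}" "y \<in> {1..n}" "(x + k) mod n = (y + k) mod n"
  shows "x = y"
proof -
  have "x = y" if "x \<le> y" "x \<in> {1..n}" "y \<in> {1..n}" "(y + k) mod n = (x + k) mod n" for x y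
  proof -
    have "n dvd (y + k) - (x + k)"
      using that(1,4) by (subst mod_eq_dvd_iff_nat[symmetric]) auto
    then have "n dvd y - x" by simp
    moreover have "y - x < n" using that by auto
    ultimately show ?thesis using that(1) by (metis dvd_imp_le le_antisym linorder_not_le zero_less_diff)
  qed
  from this[of x y] this[of y x] assms show ?thesis by (metis nat_le_linear)
qed

text \<open>
The cyclic rectangle, whose entry in row \<open>r\<close> and column \<open>c\<close> is \<open>(c + r) mod n + 1\<close>, is Latin.
Without a rectangle there would be no uniform distribution to speak of.
\<close>

lemma latin_rectangles_nonempty:
  assumes "m \<le> n"
  shows "latin_rectangles m n \<noteq> {}"
proof -
  define R where "R = (\<lambda>r\<in>{1..m}. \<lambda>c. if c \<in> {1..n} then (c + r) mod n + 1 else c)"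
  have row: "R r permutes {1..n}" if "r \<in> {1..m}" for r
  proof (rule bij_imp_permutes)
    have "inj_on (R r) {1..n}"
    proof (rule inj_onI)
      fix x y assume "x \<in> {1..n}" "y \<in> {1..n}" "R r x = R r y"
      then show "x = y" using that mod_shift_inj[of x n y r] by (simp add: R_def)
    qed
    moreover have "R r ` {1..n} \<subseteq> {1..n}"
      using that by (auto simp: R_def Suc_le_eq)
    ultimately show "bij_betw (R r) {1..n} {1..n}"
      by (simp add: bij_betw_def endo_inj_surj)
  qed (use that in \<open>auto simp: R_def\<close>)
  moreover have "inj_on (\<lambda>r. R r c) {1..m}" if "c \<in> {1..n}" for c
  proof (rule inj_onI)
    fix r s assume "r \<in> {1..m}" "s \<in> {1..m}" "R r c = R s c"
    then show "r = s"
      using that assms mod_shift_inj[of r n s c] by (simp add: R_def add.commute)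
  qed
  moreover have "R \<in> {1..m} \<rightarrow>\<^sub>E {p. p permutes {1..n}}"
    using row by (auto simp: R_def)
  ultimately have "R \<in> latin_rectangles m n"
    unfolding latin_rectangles_def by blast
  then show ?thesis by blast
qed

lemma row_permutes:
  assumes "R \<in> latin_rectangles m n" "r \<in> {1..m}"
  shows "R r permutes {1..n}"
  using assms by (auto simp: latin_rectangles_def dest: PiE_mem)

lemma column_inj_on:
  assumes "R \<in> latin_rectangles m n" "c \<in> {1..n}"
  shows "inj_on (\<lambda>r. R r c) {1..m}"
  using assms by (simp add: latin_rectangles_def)

lemma finite_column_symbols: "finite (column_symbols m R c)"
  by (simp add: column_symbols_def)

lemma card_column_symbols:
  assumes "R \<in> latin_rectangles m n" "c \<in> {1..n}"
  shows "card (column_symbols m R c) = m"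
  using card_image[OF column_inj_on[OF assms]] by (simp add: column_symbols_def)

lemma column_symbols_subset:
  assumes "R \<in> latin_rectangles m n" "c \<in> {1..n}"
  shows "column_symbols m R c \<subseteq> {1..n}"
  unfolding column_symbols_def
  using assms row_permutes by (intro image_subsetI) (metis permutes_in_image)

text \<open>
Each row shows the symbol exactly once, and different rows show it in different columns.
\<close>

lemma card_columns_containing:
  assumes R: "R \<in> latin_rectangles m n" and s: "s \<in> {1..n}"
  shows "card {c \<in> {1..n}. s \<in> column_symbols m R c} = m"
proof -
  define col where "col r = inv (R r) s" for r
  have col: "R r (col r) = s" "col r \<in> {1..n}" if "r \<in> {1..m}" for r
  proof -
    have perm: "R r permutes {1..n}" using R that by (rule row_permutes)
    then show "R r (col r) = s" by (simp add: col_def permutes_inverses(1))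
    show "col r \<in> {1..n}"
      unfolding col_def using permutes_in_image[OF permutes_inv[OF perm], of s] s by simp
  qed
  have unique: "c = col r" if "r \<in> {1..m}" "R r c = s" for r c
    using permutes_inverses(2)[OF row_permutes[OF R that(1)], of c] that(2) by (simp add: col_def)
  have "{c \<in> {1..n}. s \<in> column_symbols m R c} = col ` {1..m}"
  proof (intro subset_antisym subsetI)
    fix c assume "c \<in> {c \<in> {1..n}. s \<in> column_symbols m R c}"
    then obtain r where "r \<in> {1..m}" "R r c = s" by (auto simp: column_symbols_def)
    then show "c \<in> col ` {1..m}" using unique by blast
  next
    fix c assume "c \<in> col ` {1..m}"
    then obtain r where "r \<in> {1..m}" "c = col r" by blast
    then show "c \<in> {c \<in> {1..n}. s \<in> column_symbols m R c}"
      using col by (auto simp: column_symbols_def intro!: image_eqI[of _ _ r])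
  qed
  moreover have "inj_on col {1..m}"
  proof (rule inj_onI)
    fix r r' assume *: "r \<in> {1..m}" "r' \<in> {1..m}" "col r = col r'"
    then have "R r (col r) = R r' (col r)" using col(1) by metis
    then show "r = r'" using column_inj_on[OF R col(2)[OF *(1)]] * by (auto dest: inj_onD)
  qed
  ultimately show ?thesis by (simp add: card_image)
qed

lemma sum_card_columns_inter:
  assumes R: "R \<in> latin_rectangles m n" and D: "D \<subseteq> {1..n}"
  shows "(\<Sum>c\<in>{1..n}. card (column_symbols m R c \<inter> D)) = m * card D"
proof -
  have fin: "finite D" using D by (rule finite_subset) simp
  have "(\<Sum>c\<in>{1..n}. card (column_symbols m R c \<inter> D)) = (\<Sum>c\<in>{1..n}. card {s \<in> D. s \<in> column_symbols m R c})"
    by (simp add: Int_def conj_commute)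
  also have "\<dots> = (\<Sum>s\<in>D. card {c \<in> {1..n}. s \<in> column_symbols m R c})"
    using fin by (intro sum_multicount_gen) auto
  also have "\<dots> = (\<Sum>s\<in>D. m)"
    using D by (intro sum.cong refl card_columns_containing[OF R]) (rule subsetD)
  finally show ?thesis by simp
qed

lemma real_card_Diff: "finite A \<Longrightarrow> B \<subseteq> A \<Longrightarrow> real (card (A - B)) = real (card A) - real (card B)"
  by (simp add: card_Diff_subset finite_subset card_mono of_nat_diff)

section \<open>Switching two columns along a path\<close>

definition column_trails :: "nat \<Rightarrow> (nat \<Rightarrow> nat \<Rightarrow> nat) \<Rightarrow> nat \<Rightarrow> nat \<Rightarrow> nat list set" where
  "column_trails m R a h = maximal_trails (\<lambda>r. R r a) (\<lambda>r. R r h) {1..m}"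

definition switch_columns ::
  "nat \<Rightarrow> nat \<Rightarrow> nat set \<Rightarrow> (nat \<Rightarrow> nat \<Rightarrow> nat) \<Rightarrow> nat \<Rightarrow> nat \<Rightarrow> nat" where
  "switch_columns a h P R = (\<lambda>r. if r \<in> P then R r \<circ> Transposition.transpose a h else R r)"

lemma switch_columns_column:
  "(\<lambda>r. switch_columns a h P R r a) = override_on (\<lambda>r. R r a) (\<lambda>r. R r h) P"
  "(\<lambda>r. switch_columns a h P R r h) = override_on (\<lambda>r. R r h) (\<lambda>r. R r a) P"
  "c \<noteq> a \<Longrightarrow> c \<noteq> h \<Longrightarrow> (\<lambda>r. switch_columns a h P R r c) = (\<lambda>r. R r c)"
  by (auto simp: switch_columns_def override_on_def)

lemma switch_columns_involution: "switch_columns a h P (switch_columns a h P R) = R"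
  by (auto simp: switch_columns_def fun_eq_iff)

context
  fixes m n a h :: nat and R :: "nat \<Rightarrow> nat \<Rightarrow> nat"
  assumes R: "R \<in> latin_rectangles m n" and a: "a \<in> {1..n}" and h: "h \<in> {1..n}"
begin

interpretation degree_one_arcs "\<lambda>r. R r a" "\<lambda>r. R r h" "{1..m}"
  using column_inj_on[OF R a] column_inj_on[OF R h] by unfold_locales simp_all

lemma finite_column_trails: "finite (column_trails m R a h)"
  unfolding column_trails_def by (rule finite_maximal_trails)

lemma bij_betw_column_trail_source:
  "bij_betw (\<lambda>p. R (hd p) a) (column_trails m R a h) (column_symbols m R a - column_symbols m R h)"
  unfolding column_trails_def column_symbols_def by (rule bij_betw_source)

lemma bij_betw_column_trail_sink:
  "bij_betw (\<lambda>p. R (last p) h) (column_trails m R a h) (column_symbols m R h - column_symbols m R a)"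
  unfolding column_trails_def column_symbols_def by (rule bij_betw_sink)

text \<open>
Each row stays a permutation because two of its entries are exchanged; columns \<open>a\<close> and \<open>h\<close> keep distinct
entries because all rows of a path component are switched together.
\<close>

lemma switch_columns_in_latin_rectangles:
  assumes p: "p \<in> column_trails m R a h"
  shows "switch_columns a h (set p) R \<in> latin_rectangles m n"
proof -
  note p' = p[unfolded column_trails_def]
  have sub: "set p \<subseteq> {1..m}" using p' by (simp add: maximal_trails_def)
  have "switch_columns a h (set p) R r permutes {1..n}" if "r \<in> {1..m}" for r
    using row_permutes[OF R that] permutes_compose[OF permutes_swap_id[OF a h]]
    by (simp add: switch_columns_def)
  moreover have "switch_columns a h (set p) R r = undefined" if "r \<notin> {1..m}" for r
  proof -
    have "r \<notin> set p" using that sub by blast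
    moreover have "R \<in> {1..m} \<rightarrow>\<^sub>E {p. p permutes {1..n}}" using R by (simp add: latin_rectangles_def)
    ultimately show ?thesis
      unfolding switch_columns_def using PiE_arb that by metis
  qed
  moreover have "inj_on (\<lambda>r. switch_columns a h (set p) R r c) {1..m}" if "c \<in> {1..n}" for c
  proof -
    consider "c = a" | "c = h" | "c \<noteq> a" "c \<noteq> h" by blast
    then show ?thesis
    proof cases
      case 1
      then show ?thesis using inj_on_switch_tail[OF p'] by (simp only: switch_columns_column)
    next
      case 2
      then show ?thesis using switch_images(2)[OF p'] by (simp only: switch_columns_column)
    next
      case 3
      then show ?thesis using column_inj_on[OF R that] by (simp only: switch_columns_column(3) not_False_eq_True)
    qed
  qed
  ultimately show ?thesis
    unfolding latin_rectangles_def by (simp add: PiE_iff extensional_def)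
qed

lemma rev_in_switched_column_trails:
  assumes p: "p \<in> column_trails m R a h"
  shows "rev p \<in> column_trails m (switch_columns a h (set p) R) a h"
  using rev_in_switch_maximal_trails[OF p[unfolded column_trails_def]]
  by (simp only: column_trails_def switch_columns_column)

text \<open>
Column \<open>a\<close> loses the initial symbol of the path and gains the terminal one, while column \<open>b\<close> is untouched.
\<close>

lemma overlap_switch_columns:
  assumes p: "p \<in> column_trails m R a h" and b: "b \<noteq> a" "b \<noteq> h"
  shows "real (overlap m a b (switch_columns a h (set p) R)) = real (overlap m a b R)
    + of_bool (R (last p) h \<in> column_symbols m R b) - of_bool (R (hd p) a \<in> column_symbols m R b)"
proof -
  note p' = p[unfolded column_trails_def]
  let ?R = "switch_columns a h (set p) R" and ?u = "R (hd p) a" and ?v = "R (last p) h"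
  let ?Sa = "column_symbols m R a" and ?Sb = "column_symbols m R b"
  have b': "column_symbols m ?R b = ?Sb"
    unfolding column_symbols_def by (simp only: switch_columns_column(3)[OF b])
  have a': "column_symbols m ?R a = insert ?v (?Sa - {?u})"
    unfolding column_symbols_def using switch_tail_image[OF p'] by (simp only: switch_columns_column(1))
  have u: "?u \<in> ?Sa" and v: "?v \<notin> ?Sa"
    using bij_betwE[OF bij_betw_column_trail_source] bij_betwE[OF bij_betw_column_trail_sink] p by blast+
  have fin: "finite (?Sa \<inter> ?Sb)" by (simp add: finite_column_symbols)
  have del: "real (card (?Sa \<inter> ?Sb - {?u})) = real (card (?Sa \<inter> ?Sb)) - of_bool (?u \<in> ?Sb)"
  proof (cases "?u \<in> ?Sb")
    case True
    then have "card (?Sa \<inter> ?Sb) > 0" using u fin by (auto simp: card_gt_0_iff)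
    then show ?thesis using True u by (simp add: card_Diff_singleton of_nat_diff)
  qed simp
  show ?thesis
  proof (cases "?v \<in> ?Sb")
    case True
    then have "insert ?v (?Sa - {?u}) \<inter> ?Sb = insert ?v (?Sa \<inter> ?Sb - {?u})" by auto
    then show ?thesis unfolding overlap_def a' b' using del True v fin by simp
  next
    case False
    then have "insert ?v (?Sa - {?u}) \<inter> ?Sb = ?Sa \<inter> ?Sb - {?u}" by auto
    then show ?thesis unfolding overlap_def a' b' using del False by simp
  qed
qed

lemma degree_one_column_digraph: "degree_one_digraph (column_digraph m n R a h)"
proof -
  have "R r c \<in> {1..n}" if "r \<in> {1..m}" "c \<in> {1..n}" for r c
    using permutes_in_image[OF row_permutes[OF R that(1)]] that(2) by simp
  then have "wf_digraph (column_digraph m n R a h)"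
    using a h by (intro wf_digraph.intro) (simp_all add: column_digraph_def)
  moreover have "degree_one_arcs (tail (column_digraph m n R a h)) (head (column_digraph m n R a h))
      (arcs (column_digraph m n R a h))"
    using degree_one_arcs_axioms by (simp add: column_digraph_def)
  ultimately show ?thesis by (rule degree_one_digraph.intro)
qed

text \<open>
Endpoint conditions on path components become conditions on the first and last rows of trails.
\<close>

lemma card_path_components_with_endpoints_in:
  "card {Q \<in> path_components (column_digraph m n R a h). path_endpoints Q \<subseteq> S} =
   card {p \<in> column_trails m R a h. R (hd p) a \<in> S \<and> R (last p) h \<in> S}"
  (is "card ?Qs = card ?ps")
proof -
  let ?G = "column_digraph m n R a h"
  interpret G: degree_one_digraph ?G by (rule degree_one_column_digraph)
  have G: "tail ?G = (\<lambda>r. R r a)" "head ?G = (\<lambda>r. R r h)" "arcs ?G = {1..m}"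
    by (simp_all add: column_digraph_def)
  have bij: "bij_betw (trail_digraph ?G) (column_trails m R a h) (path_components ?G)"
    using G.bij_betw_trail_digraph unfolding G column_trails_def .
  have ends: "path_endpoints (trail_digraph ?G p) = {R (hd p) a, R (last p) h}"
    if "p \<in> column_trails m R a h" for p
    using G.path_endpoints_trail_digraph[unfolded G, folded column_trails_def, OF that] .
  have "inj_on (trail_digraph ?G) ?ps"
    using bij_betw_imp_inj_on[OF bij] by (rule inj_on_subset) simp
  then have "card (trail_digraph ?G ` ?ps) = card ?ps" by (rule card_image)
  moreover have "trail_digraph ?G ` ?ps = ?Qs"
  proof (intro subset_antisym subsetI)
    fix Q assume "Q \<in> trail_digraph ?G ` ?ps"
    then show "Q \<in> ?Qs" using ends bij_betwE[OF bij] by auto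
  next
    fix Q assume Q: "Q \<in> ?Qs"
    then obtain p where "p \<in> column_trails m R a h" "Q = trail_digraph ?G p"
      using bij_betw_imp_surj_on[OF bij] by blast
    then show "Q \<in> trail_digraph ?G ` ?ps" using Q ends by auto
  qed
  ultimately show ?thesis by (simp only:)
qed

text \<open>
The sources are the symbols of column \<open>a\<close> missing in column \<open>h\<close>. Triple intersections appear here and
for the sinks alike, with the shape needed to sum them over \<open>h\<close>.
\<close>

lemma sum_sources_in:
  "(\<Sum>p\<in>column_trails m R a h. of_bool (R (hd p) a \<in> S)) =
   real (card (column_symbols m R a \<inter> S)) - real (card (column_symbols m R h \<inter> (column_symbols m R a \<inter> S)))"
proof -
  let ?Sa = "column_symbols m R a" and ?Sh = "column_symbols m R h"
  have "(\<Sum>p\<in>column_trails m R a h. of_bool (R (hd p) a \<in> S)) = (\<Sum>s\<in>?Sa - ?Sh. of_bool (s \<in> S) :: real)"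
    by (rule sum.reindex_bij_betw[OF bij_betw_column_trail_source])
  also have "\<dots> = real (card ((?Sa - ?Sh) \<inter> S))"
    by (simp add: finite_column_symbols sum_of_bool_eq Int_def)
  also have "(?Sa - ?Sh) \<inter> S = ?Sa \<inter> S - ?Sh \<inter> (?Sa \<inter> S)" by blast
  also have "real (card \<dots>) = real (card (?Sa \<inter> S)) - real (card (?Sh \<inter> (?Sa \<inter> S)))"
    by (rule real_card_Diff) (auto simp: finite_column_symbols)
  finally show ?thesis .
qed

lemma sum_sinks_in:
  "(\<Sum>p\<in>column_trails m R a h. of_bool (R (last p) h \<in> S)) =
   real (card (column_symbols m R h \<inter> S)) - real (card (column_symbols m R h \<inter> (column_symbols m R a \<inter> S)))"
proof -
  let ?Sa = "column_symbols m R a" and ?Sh = "column_symbols m R h"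
  have "(\<Sum>p\<in>column_trails m R a h. of_bool (R (last p) h \<in> S)) = (\<Sum>s\<in>?Sh - ?Sa. of_bool (s \<in> S) :: real)"
    by (rule sum.reindex_bij_betw[OF bij_betw_column_trail_sink])
  also have "\<dots> = real (card ((?Sh - ?Sa) \<inter> S))"
    by (simp add: finite_column_symbols sum_of_bool_eq Int_def)
  also have "(?Sh - ?Sa) \<inter> S = ?Sh \<inter> S - ?Sh \<inter> (?Sa \<inter> S)" by blast
  also have "real (card \<dots>) = real (card (?Sh \<inter> S)) - real (card (?Sh \<inter> (?Sa \<inter> S)))"
    by (rule real_card_Diff) (auto simp: finite_column_symbols)
  finally show ?thesis .
qed

end

section \<open>Moments of the overlap change under a random switch\<close>

lemma finite_path_components_column_digraph:
  assumes R: "R \<in> latin_rectangles m n" and a: "a \<in> {1..n}" and h: "h \<in> {1..n}"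
  shows "finite (path_components (column_digraph m n R a h))"
proof -
  interpret G: degree_one_digraph "column_digraph m n R a h"
    using assms by (rule degree_one_column_digraph)
  show ?thesis
    using G.finite_maximal_trails bij_betw_finite[OF G.bij_betw_trail_digraph] by (simp only:)
qed

context
  fixes m n a b :: nat
  assumes a: "a \<in> {1..n}" and b: "b \<in> {1..n}" and ab: "a \<noteq> b"
begin

lemma sum_other_columns:
  fixes f :: "nat \<Rightarrow> 'c::ab_group_add"
  shows "(\<Sum>h\<in>{1..n} - {a, b}. f h) = (\<Sum>h\<in>{1..n}. f h) - f a - f b"
  using a b ab by (simp add: sum_diff)

lemma card_other_columns: "real (card ({1..n} - {a, b})) = real n - 2"
  using sum_other_columns[of "\<lambda>_. 1 :: real"] by simp

context
  fixes R :: "nat \<Rightarrow> nat \<Rightarrow> nat"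
  assumes R: "R \<in> latin_rectangles m n"
begin

lemma sum_other_columns_meeting:
  "(\<Sum>h\<in>{1..n} - {a, b}. real (card (column_symbols m R h \<inter> column_symbols m R b))) =
   real m * (real m - 1) - real (overlap m a b R)"
proof -
  let ?Sb = "column_symbols m R b"
  have "(\<Sum>h\<in>{1..n}. real (card (column_symbols m R h \<inter> ?Sb))) = real (m * card ?Sb)"
    unfolding sum_card_columns_inter[OF R column_symbols_subset[OF R b], symmetric] by simp
  then show ?thesis
    unfolding sum_other_columns
    by (simp add: card_column_symbols[OF R b] overlap_def algebra_simps)
qed

lemma sum_other_columns_meeting_both:
  "(\<Sum>h\<in>{1..n} - {a, b}. real (card (column_symbols m R h \<inter> (column_symbols m R a \<inter> column_symbols m R b)))) =
   (real m - 2) * real (overlap m a b R)"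
proof -
  let ?D = "column_symbols m R a \<inter> column_symbols m R b"
  have sub: "?D \<subseteq> {1..n}" using column_symbols_subset[OF R a] by blast
  have "column_symbols m R a \<inter> ?D = ?D" "column_symbols m R b \<inter> ?D = ?D" by auto
  moreover have "(\<Sum>h\<in>{1..n}. real (card (column_symbols m R h \<inter> ?D))) = real (m * card ?D)"
    unfolding sum_card_columns_inter[OF R sub, symmetric] by simp
  ultimately show ?thesis
    unfolding sum_other_columns by (simp add: overlap_def algebra_simps)
qed

text \<open>
Blockers are counted over all columns other than \<open>a\<close>, whereas switching avoids column \<open>b\<close> as well. The
column \<open>h = b\<close> contributes nothing, since the initial symbol of a path in the \<open>(a, b)\<close>-digraph is not in
column \<open>b\<close>.
\<close>

lemma anchored_blockers_eq_sum_trails: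
  "real (anchored_blockers m n a b R) =
    (\<Sum>h\<in>{1..n} - {a, b}. \<Sum>p\<in>column_trails m R a h.
       of_bool (R (hd p) a \<in> column_symbols m R b \<and> R (last p) h \<in> column_symbols m R b))"
proof -
  let ?Sb = "column_symbols m R b"
  let ?Q = "\<lambda>h. {Q \<in> path_components (column_digraph m n R a h). path_endpoints Q \<subseteq> ?Sb}"
  let ?f = "\<lambda>h. \<Sum>p\<in>column_trails m R a h. of_bool (R (hd p) a \<in> ?Sb \<and> R (last p) h \<in> ?Sb) :: real"
  have card_Q: "real (card (?Q h)) = ?f h" if "h \<in> {1..n}" for h
    using finite_column_trails[OF R a that]
    by (simp add: card_path_components_with_endpoints_in[OF R a that] sum_of_bool_eq Int_def)
  have "{(h, Q). h \<in> {1..n} \<and> h \<noteq> a \<and> Q \<in> path_components (column_digraph m n R a h) \<and>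
      path_endpoints Q \<subseteq> ?Sb} = Sigma ({1..n} - {a}) ?Q" by auto
  then have "anchored_blockers m n a b R = card (Sigma ({1..n} - {a}) ?Q)"
    by (simp only: anchored_blockers_def)
  also have "\<dots> = (\<Sum>h\<in>{1..n} - {a}. card (?Q h))"
    using finite_path_components_column_digraph[OF R a] by (intro card_SigmaI) auto
  finally have "real (anchored_blockers m n a b R) = (\<Sum>h\<in>{1..n} - {a}. real (card (?Q h)))"
    by (simp only: of_nat_sum)
  also have "\<dots> = (\<Sum>h\<in>{1..n} - {a}. ?f h)"
    by (intro sum.cong refl card_Q) (rule DiffD1)
  also have "{1..n} - {a} = insert b ({1..n} - {a, b})" using b ab by blast
  also have "(\<Sum>h\<in>insert b ({1..n} - {a, b}). ?f h) = ?f b + (\<Sum>h\<in>{1..n} - {a, b}. ?f h)"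
    by (rule sum.insert) simp_all
  also have "?f b = 0"
  proof (rule sum.neutral, rule ballI)
    fix p assume "p \<in> column_trails m R a b"
    then have "R (hd p) a \<notin> ?Sb"
      using bij_betwE[OF bij_betw_column_trail_source[OF R a b]] by blast
    then show "of_bool (R (hd p) a \<in> ?Sb \<and> R (last p) b \<in> ?Sb) = (0 :: real)" by simp
  qed
  finally show ?thesis by simp
qed

lemma sum_source_indicator:
  "(\<Sum>h\<in>{1..n} - {a, b}. \<Sum>p\<in>column_trails m R a h. of_bool (R (hd p) a \<in> column_symbols m R b)) =
   (real n - real m) * real (overlap m a b R)"
proof -
  have "(\<Sum>h\<in>{1..n} - {a, b}. \<Sum>p\<in>column_trails m R a h. of_bool (R (hd p) a \<in> column_symbols m R b)) =
      (\<Sum>h\<in>{1..n} - {a, b}. real (overlap m a b R)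
        - real (card (column_symbols m R h \<inter> (column_symbols m R a \<inter> column_symbols m R b))))"
    unfolding overlap_def by (intro sum.cong refl sum_sources_in[OF R a]) (rule DiffD1)
  also have "\<dots> = (real n - 2) * real (overlap m a b R) - (real m - 2) * real (overlap m a b R)"
    unfolding sum_subtractf sum_other_columns_meeting_both sum_constant card_other_columns ..
  finally show ?thesis by (simp add: algebra_simps)
qed

lemma sum_sink_indicator:
  "(\<Sum>h\<in>{1..n} - {a, b}. \<Sum>p\<in>column_trails m R a h. of_bool (R (last p) h \<in> column_symbols m R b)) =
   (real m - 1) * (real m - real (overlap m a b R))"
proof -
  have "(\<Sum>h\<in>{1..n} - {a, b}. \<Sum>p\<in>column_trails m R a h. of_bool (R (last p) h \<in> column_symbols m R b)) =
      (\<Sum>h\<in>{1..n} - {a, b}. real (card (column_symbols m R h \<inter> column_symbols m R b))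
        - real (card (column_symbols m R h \<inter> (column_symbols m R a \<inter> column_symbols m R b))))"
    by (intro sum.cong refl sum_sinks_in[OF R a]) (rule DiffD1)
  also have "\<dots> = real m * (real m - 1) - real (overlap m a b R) - (real m - 2) * real (overlap m a b R)"
    unfolding sum_subtractf sum_other_columns_meeting_both sum_other_columns_meeting ..
  finally show ?thesis by (simp add: algebra_simps)
qed

lemma overlap_switched:
  assumes "h \<in> {1..n} - {a, b}" "p \<in> column_trails m R a h"
  shows "real (overlap m a b (switch_columns a h (set p) R)) - real (overlap m a b R) =
    of_bool (R (last p) h \<in> column_symbols m R b) - of_bool (R (hd p) a \<in> column_symbols m R b)"
  using overlap_switch_columns[OF R a _ assms(2), of b] assms(1) ab by simp

text \<open>
The drift of the overlap, summed over all available switches, is an affine function of the overlap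
alone: the double counts over all columns leave no other statistic of the rectangle.
\<close>

lemma sum_overlap_change:
  "(\<Sum>h\<in>{1..n} - {a, b}. \<Sum>p\<in>column_trails m R a h.
      real (overlap m a b (switch_columns a h (set p) R)) - real (overlap m a b R)) =
   real m * (real m - 1) - (real n - 1) * real (overlap m a b R)"
proof -
  have "(\<Sum>h\<in>{1..n} - {a, b}. \<Sum>p\<in>column_trails m R a h.
      real (overlap m a b (switch_columns a h (set p) R)) - real (overlap m a b R)) =
     (\<Sum>h\<in>{1..n} - {a, b}. \<Sum>p\<in>column_trails m R a h.
      of_bool (R (last p) h \<in> column_symbols m R b) - of_bool (R (hd p) a \<in> column_symbols m R b))"
    by (intro sum.cong refl overlap_switched)
  also have "\<dots> = (real m - 1) * (real m - real (overlap m a b R)) - (real n - real m) * real (overlap m a b R)"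
    unfolding sum_subtractf sum_source_indicator sum_sink_indicator ..
  finally show ?thesis by (simp add: algebra_simps)
qed

text \<open>
The overlap changes, by one, exactly when precisely one endpoint of the path lies in column \<open>b\<close>. Paths with both endpoints
there are the blockers, and they enter with weight two because they are counted among both the
sources and the sinks.
\<close>

lemma sum_overlap_change_squares:
  "(\<Sum>h\<in>{1..n} - {a, b}. \<Sum>p\<in>column_trails m R a h.
      (real (overlap m a b (switch_columns a h (set p) R)) - real (overlap m a b R))\<^sup>2) =
   real m * (real m - 1) + (real n + 1 - 2 * real m) * real (overlap m a b R)
     - 2 * real (anchored_blockers m n a b R)"
proof -
  have sq: "(of_bool A - of_bool B)\<^sup>2 = of_bool A + of_bool B - 2 * (of_bool (B \<and> A) :: real)" for A B
    by (simp add: of_bool_def)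
  have "(\<Sum>h\<in>{1..n} - {a, b}. \<Sum>p\<in>column_trails m R a h.
      (real (overlap m a b (switch_columns a h (set p) R)) - real (overlap m a b R))\<^sup>2) =
     (\<Sum>h\<in>{1..n} - {a, b}. \<Sum>p\<in>column_trails m R a h.
      of_bool (R (last p) h \<in> column_symbols m R b) + of_bool (R (hd p) a \<in> column_symbols m R b)
      - 2 * of_bool (R (hd p) a \<in> column_symbols m R b \<and> R (last p) h \<in> column_symbols m R b))"
    unfolding sq[symmetric] by (intro sum.cong refl arg_cong[where f = "\<lambda>x. x\<^sup>2"] overlap_switched)
  also have "\<dots> = (real m - 1) * (real m - real (overlap m a b R)) + (real n - real m) * real (overlap m a b R)
      - 2 * real (anchored_blockers m n a b R)"
    unfolding sum_subtractf sum.distrib sum_distrib_left[symmetric]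
      sum_source_indicator sum_sink_indicator anchored_blockers_eq_sum_trails ..
  finally show ?thesis by (simp add: algebra_simps)
qed

end

text \<open>
The map sending a rectangle and a path to the switched rectangle and the reversed path is an
involution, so that the marginal law of the rectangle is the same before and after the switch.
\<close>

lemma sum_switched:
  fixes g :: "(nat \<Rightarrow> nat \<Rightarrow> nat) \<Rightarrow> real"
  assumes h: "h \<in> {1..n}"
  shows "(\<Sum>R\<in>latin_rectangles m n. \<Sum>p\<in>column_trails m R a h. g (switch_columns a h (set p) R)) =
    (\<Sum>R\<in>latin_rectangles m n. \<Sum>p\<in>column_trails m R a h. g R)"
proof -
  let ?W = "Sigma (latin_rectangles m n) (\<lambda>R. column_trails m R a h)"
  let ?s = "\<lambda>(R, p). (switch_columns a h (set p) R, rev p)"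
  have fin: "\<forall>R\<in>latin_rectangles m n. finite (column_trails m R a h)"
    using finite_column_trails a h by blast
  have s_in: "?s w \<in> ?W" if "w \<in> ?W" for w
    using that switch_columns_in_latin_rectangles[OF _ a h] rev_in_switched_column_trails[OF _ a h]
    by (auto simp del: set_rev)
  have s_inv: "?s (?s w) = w" for w
    by (cases w) (simp add: switch_columns_involution)
  have "(\<Sum>(R, p)\<in>?W. g (switch_columns a h (set p) R)) = (\<Sum>(R, p)\<in>?W. g R)"
    by (rule sum.reindex_bij_witness[of _ ?s ?s]) (use s_in s_inv in \<open>auto simp: split_def\<close>)
  then show ?thesis
    by (simp only: sum.Sigma[OF finite_latin_rectangles fin])
qed

lemma sum_all_switched:
  fixes g :: "(nat \<Rightarrow> nat \<Rightarrow> nat) \<Rightarrow> real"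
  shows "(\<Sum>R\<in>latin_rectangles m n. \<Sum>h\<in>{1..n} - {a, b}. \<Sum>p\<in>column_trails m R a h.
      g (switch_columns a h (set p) R) - g R) = 0"
proof -
  have "(\<Sum>R\<in>latin_rectangles m n. \<Sum>p\<in>column_trails m R a h. g (switch_columns a h (set p) R) - g R) = 0"
    if "h \<in> {1..n} - {a, b}" for h
    unfolding sum_subtractf using sum_switched[of h g] that by simp
  then have "(\<Sum>h\<in>{1..n} - {a, b}. \<Sum>R\<in>latin_rectangles m n. \<Sum>p\<in>column_trails m R a h.
      g (switch_columns a h (set p) R) - g R) = 0"
    by (rule sum.neutral[OF ballI])
  then show ?thesis by (subst sum.swap)
qed

lemma sum_overlap_latin_rectangles:
  "(\<Sum>R\<in>latin_rectangles m n. real m * (real m - 1) - (real n - 1) * real (overlap m a b R)) = 0"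
  using sum_all_switched[of "\<lambda>R. real (overlap m a b R)"]
  by (simp only: sum_overlap_change cong: sum.cong)

lemma sum_overlap_squares_latin_rectangles:
  "(\<Sum>R\<in>latin_rectangles m n.
      2 * real (overlap m a b R) * (real m * (real m - 1) - (real n - 1) * real (overlap m a b R)) +
      (real m * (real m - 1) + (real n + 1 - 2 * real m) * real (overlap m a b R)
        - 2 * real (anchored_blockers m n a b R))) = 0"
proof -
  let ?Z = "\<lambda>R. real (overlap m a b R)"
  have "(\<Sum>h\<in>{1..n} - {a, b}. \<Sum>p\<in>column_trails m R a h. (?Z (switch_columns a h (set p) R))\<^sup>2 - (?Z R)\<^sup>2) =
      2 * ?Z R * (real m * (real m - 1) - (real n - 1) * ?Z R) +
      (real m * (real m - 1) + (real n + 1 - 2 * real m) * ?Z R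
        - 2 * real (anchored_blockers m n a b R))" if "R \<in> latin_rectangles m n" for R
  proof -
    \<comment> \<open>splits the change of the square into the drift and the squared displacement\<close>
    have "(x::real)\<^sup>2 - y\<^sup>2 = 2 * y * (x - y) + (x - y)\<^sup>2" for x y
      by (simp add: power2_eq_square algebra_simps)
    then show ?thesis
      by (simp only: sum.distrib sum_distrib_left[symmetric]
          sum_overlap_change[OF that] sum_overlap_change_squares[OF that])
  qed
  then show ?thesis
    using sum_all_switched[of "\<lambda>R. (?Z R)\<^sup>2"] by (simp only: cong: sum.cong)
qed

end

section \<open>The variance of the overlap\<close>

theorem proposition4p5:
  fixes m n d a b :: nat
  assumes "1 \<le> m" and "m < n" and "d = n - m"
    and "a \<in> {1..n}" and "b \<in> {1..n}" and "a \<noteq> b"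
  shows "measure_pmf.variance (uniform_latin_rectangle m n) (\<lambda>R. real (overlap m a b R)) =
           real m * (real m - 1) * real d / (real n - 1)\<^sup>2
           - measure_pmf.expectation (uniform_latin_rectangle m n)
               (\<lambda>R. real (anchored_blockers m n a b R)) / (real n - 1)
       \<and> measure_pmf.variance (uniform_latin_rectangle m n) (\<lambda>R. real (overlap m a b R)) \<le>
           real m * (real m - 1) * real d / (real n - 1)\<^sup>2"
proof -
  let ?L = "latin_rectangles m n"
  let ?P = "uniform_latin_rectangle m n"
  let ?Z = "\<lambda>R. real (overlap m a b R)" and ?B = "\<lambda>R. real (anchored_blockers m n a b R)"
  define M where "M = real m * (real m - 1)"
  define q where "q = real n - 1"
  have q: "q > 0" using assms(1,2) by (simp add: q_def)
  have L: "?L \<noteq> {}" "finite ?L"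
    using assms(2) by (simp_all add: latin_rectangles_nonempty finite_latin_rectangles)
  have E: "measure_pmf.expectation ?P f = (\<Sum>R\<in>?L. f R) / real (card ?L)" for f :: "_ \<Rightarrow> real"
    unfolding uniform_latin_rectangle_def by (rule integral_pmf_of_set[OF L])
  have int: "integrable (measure_pmf ?P) f" for f :: "_ \<Rightarrow> real"
    using L by (intro integrable_measure_pmf_finite) (simp add: uniform_latin_rectangle_def)
  have "measure_pmf.expectation ?P (\<lambda>R. M - q * ?Z R) = 0"
    unfolding E M_def q_def sum_overlap_latin_rectangles[OF assms(4-6)] by simp
  then have mean: "q * measure_pmf.expectation ?P ?Z = M"
    using int by simp
  have "measure_pmf.expectation ?P
      (\<lambda>R. 2 * ?Z R * (M - q * ?Z R) + (M + (real n + 1 - 2 * real m) * ?Z R - 2 * ?B R)) = 0"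
    unfolding E M_def q_def sum_overlap_squares_latin_rectangles[OF assms(4-6)] by simp
  also have "(\<lambda>R. 2 * ?Z R * (M - q * ?Z R) + (M + (real n + 1 - 2 * real m) * ?Z R - 2 * ?B R)) =
      (\<lambda>R. M + (2 * M + (real n + 1 - 2 * real m)) * ?Z R - 2 * q * (?Z R)\<^sup>2 - 2 * ?B R)"
    by (simp add: fun_eq_iff algebra_simps power2_eq_square)
  finally have second: "M + (2 * M + (real n + 1 - 2 * real m)) * measure_pmf.expectation ?P ?Z
      - 2 * q * measure_pmf.expectation ?P (\<lambda>R. (?Z R)\<^sup>2) - 2 * measure_pmf.expectation ?P ?B = 0"
    using int by simp
  have var: "measure_pmf.variance ?P ?Z =
      measure_pmf.expectation ?P (\<lambda>R. (?Z R)\<^sup>2) - (measure_pmf.expectation ?P ?Z)\<^sup>2"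
    using int by (rule measure_pmf.variance_eq) (rule int)
  \<comment> \<open>solving the two moment equations: \<open>x\<close> and \<open>x2\<close> are the first two moments of the overlap, \<open>y\<close> is the
    expected number of blockers\<close>
  have "x2 - x\<^sup>2 = M * real d / q\<^sup>2 - y / q"
    if "q * x = M" "M + (2 * M + (real n + 1 - 2 * real m)) * x - 2 * q * x2 - 2 * y = 0" for x x2 y
  proof -
    have "2 * M * x = 2 * q * x\<^sup>2"
      unfolding that(1)[symmetric] by (simp add: power2_eq_square)
    then have "2 * (q * (x2 - x\<^sup>2)) = M + (real n + 1 - 2 * real m) * x - 2 * y"
      using that(2) by (simp add: algebra_simps)
    then have "q * (2 * (q * (x2 - x\<^sup>2))) = q * (M + (real n + 1 - 2 * real m) * x - 2 * y)"
      by (rule arg_cong)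
    then have "2 * (q\<^sup>2 * (x2 - x\<^sup>2)) = q * M + (real n + 1 - 2 * real m) * (q * x) - 2 * q * y"
      by (simp add: algebra_simps power2_eq_square)
    also have "\<dots> = 2 * (M * real d - q * y)"
      unfolding that(1) using assms(2,3) by (simp add: q_def of_nat_diff algebra_simps)
    finally have "q\<^sup>2 * (x2 - x\<^sup>2) = M * real d - q * y" by simp
    then have "x2 - x\<^sup>2 = (M * real d - q * y) / q\<^sup>2" using q by (simp add: field_simps)
    then show ?thesis using q by (simp add: diff_divide_distrib power2_eq_square)
  qed
  from this[OF mean second]
  have "measure_pmf.variance ?P ?Z = M * real d / q\<^sup>2 - measure_pmf.expectation ?P ?B / q"
    unfolding var .
  moreover have "measure_pmf.expectation ?P ?B / q \<ge> 0"
    using q by (intro divide_nonneg_pos integral_nonneg) auto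
  ultimately show ?thesis unfolding M_def q_def by simp
qed

end
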